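(* Let $\hat\Sigma\in\mathbf{Q}_n$, $\hat\Sigma\succ0$, and let $0<\delta<\delta_{max}:=\log|\mathrm{diag}^2(\hat\Sigma^{-1})\hat\Sigma|$. Let $$F(\lambda,X):=-\lambda\left[\log\left|\hat\Sigma^{-1}+\lambda^{-1}X\right|+\log|\hat\Sigma|-\delta\right],$$ $$\mathcal{C}_F:=\{(\lambda,X):\ \lambda>0,\ X\in\mathbf{Q}_n,\ X\preceq I,\ -\mathrm{diag}^2(X)\succeq0,\ \hat\Sigma^{-1}+\lambda^{-1}X\succ0\}.$$ Then the dual problem $$\min_{(\lambda,X)\in\mathcal{C}_F}F(\lambda,X)$$ admits a unique solution.
   Context: $\mathbf{Q}_n$ is the space of real symmetric $n\times n$ matrices; $|M|$ is the determinant of $M$; $\mathrm{diag}^2(M)$ is the diagonal matrix with the same main diagonal as $M$. *)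

theory Defs
  imports "HOL-Analysis.Analysis"
begin

definition sym_matrices :: "(real^'n^'n) set" where
  "sym_matrices = {M. transpose M = M}"

text \<open>The relations \<open>M \<succ> 0\<close> and \<open>M \<succeq> 0\<close>, which include symmetry of \<open>M\<close>;
  \<open>A \<preceq> B\<close> is rendered as \<open>pos_semidef (B - A)\<close>.\<close>

definition pos_def :: "real^'n^'n \<Rightarrow> bool" where
  "pos_def M \<longleftrightarrow> M \<in> sym_matrices \<and> (\<forall>x. x \<noteq> 0 \<longrightarrow> 0 < x \<bullet> (M *v x))"

definition pos_semidef :: "real^'n^'n \<Rightarrow> bool" where
  "pos_semidef M \<longleftrightarrow> M \<in> sym_matrices \<and> (\<forall>x. 0 \<le> x \<bullet> (M *v x))"

definition diag2 :: "real^'n^'n \<Rightarrow> real^'n^'n" where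
  "diag2 M = (\<chi> i j. if i = j then M $ i $ i else 0)"

definition delta_max :: "real^'n^'n \<Rightarrow> real" where
  "delta_max S = ln (det (diag2 (matrix_inv S) ** S))"

definition dual_obj :: "real^'n^'n \<Rightarrow> real \<Rightarrow> real \<times> (real^'n^'n) \<Rightarrow> real" where
  "dual_obj S \<delta> = (\<lambda>(l, X).
     - l * (ln (det (matrix_inv S + inverse l *\<^sub>R X)) + ln (det S) - \<delta>))"

definition dual_feasible :: "real^'n^'n \<Rightarrow> (real \<times> (real^'n^'n)) set" where
  "dual_feasible S = {(l, X). l > 0 \<and> X \<in> sym_matrices \<and> pos_semidef (mat 1 - X) \<and>
     pos_semidef (- diag2 X) \<and> pos_def (matrix_inv S + inverse l *\<^sub>R X)}"

end

(* Put P = S^(-1) and Z = P + X/l. In the variables (l, Z) the problem is to maximise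
   l * g Z with g Z = ln (det Z) - ln (det P) - delta, subject to l > 0, Z > 0,
   Z_ii <= P_ii and l (Z - P) <= I.

   Existence: Z = diag2 P with small l gives a positive value because delta < delta_max.
   Where l * g Z > 0 we have det Z >= exp delta * det P, whereas Z <= P + I/l forces
   det Z <= det (P + I/l), which tends to det P; hence l is bounded. The entries of Z are
   bounded by its diagonal, so the maximum is taken over a compact set.

   Uniqueness: l * g (P + X/l) is the perspective of a strictly concave function. Two
   maximisers with different Z would be beaten at their midpoint, and for equal Z the
   positive common value determines l.

   Monotonicity and strict log-concavity of det come from diagonalising two forms
   simultaneously by successive maximisation of the Rayleigh quotient. *)

theory Submission
  imports Defs
begin

section \<open>Symmetric matrices and their quadratic forms\<close>

lemma sym_matrices_inner_commute:
  assumes "M \<in> sym_matrices"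
  shows "x \<bullet> (M *v y) = y \<bullet> (M *v x)"
  using assms unfolding sym_matrices_def
  by (metis (mono_tags) dot_lmul_matrix inner_commute mem_Collect_eq transpose_matrix_vector)

lemma sym_matrices_add: "A \<in> sym_matrices \<Longrightarrow> B \<in> sym_matrices \<Longrightarrow> A + B \<in> sym_matrices"
  and sym_matrices_diff: "A \<in> sym_matrices \<Longrightarrow> B \<in> sym_matrices \<Longrightarrow> A - B \<in> sym_matrices"
  and sym_matrices_scaleR: "A \<in> sym_matrices \<Longrightarrow> c *\<^sub>R A \<in> sym_matrices"
  and sym_matrices_mat: "mat k \<in> sym_matrices"
  and sym_matrices_diag2: "diag2 A \<in> sym_matrices"
  by (auto simp: sym_matrices_def transpose_def vec_eq_iff mat_def diag2_def)

lemma matrix_vector_scaleR_left: "(c *\<^sub>R A) *v x = c *\<^sub>R (A *v x)" for A :: "real^'n^'m"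
  by (rule scaleR_matrix_vector_assoc[symmetric])

lemmas quadratic_form_simps = matrix_vector_mult_add_rdistrib matrix_vector_mult_diff_rdistrib
  matrix_vector_scaleR_left matrix_vector_right_distrib matrix_vector_mult_diff_distrib
  matrix_vector_mult_scaleR inner_add_left inner_add_right inner_diff_left inner_diff_right

section \<open>Null vectors of nonnegative forms and simultaneous diagonalisation\<close>

lemma nonneg_quadratic_imp_linear_coeff_zero:
  fixes b c :: real
  assumes "\<And>t. 0 \<le> 2 * t * b + t\<^sup>2 * c"
  shows "b = 0"
proof (rule ccontr)
  assume b: "b \<noteq> 0"
  have c: "c \<ge> 0" using assms[of 1] assms[of "-1"] by simp
  \<comment> \<open>The minimiser of the quadratic is \<open>- b / c\<close>; the denominator
    \<open>c + 1\<close> also covers \<open>c = 0\<close>. At this \<open>t\<close> the quadratic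
    equals \<open>t * b - t^2\<close>, and \<open>t * b\<close> is negative.\<close>
  define t where "t = - b / (c + 1)"
  have tb: "t * (c + 1) = - b" using c by (simp add: t_def)
  have "2 * t * b + t\<^sup>2 * c = t * (2 * b + t * (c + 1)) - t\<^sup>2"
    by (simp add: algebra_simps power2_eq_square)
  also have "\<dots> = t * b - t\<^sup>2" unfolding tb by simp
  also have "t * b = - (b\<^sup>2 / (c + 1))" by (simp add: t_def power2_eq_square)
  also have "- (b\<^sup>2 / (c + 1)) - t\<^sup>2 < 0"
    using b c by (smt (verit) divide_pos_pos zero_le_power2 zero_less_power2)
  finally show False using assms[of t] by simp
qed

text \<open>The form attains its minimum 0 over \<open>W\<close> at \<open>u\<close>, so its
  derivative at \<open>u\<close> in every direction \<open>w\<close> of \<open>W\<close>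
  vanishes.\<close>

lemma nonneg_form_null_vector:
  assumes M: "M \<in> sym_matrices" and W: "subspace W"
    and nonneg: "\<And>w. w \<in> W \<Longrightarrow> 0 \<le> w \<bullet> (M *v w)"
    and u: "u \<in> W" "u \<bullet> (M *v u) = 0" and w: "w \<in> W"
  shows "w \<bullet> (M *v u) = 0"
proof (rule nonneg_quadratic_imp_linear_coeff_zero)
  fix t :: real
  have "u + t *\<^sub>R w \<in> W" using W u w by (simp add: subspace_add subspace_scale)
  from nonneg[OF this] show "0 \<le> 2 * t * (w \<bullet> (M *v u)) + t\<^sup>2 * (w \<bullet> (M *v w))"
    using u(2) sym_matrices_inner_commute[OF M, of u w]
    by (simp add: quadratic_form_simps power2_eq_square algebra_simps)
qed

text \<open>Induction on the index set: the next vector maximises the Rayleigh quotient of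
  \<open>B\<close> against \<open>A\<close> on the \<open>A\<close>-orthogonal complement of the
  vectors already found. With \<open>m\<close> the maximum, \<open>m A - B\<close> is nonnegative
  there and has the maximiser as a null vector.\<close>

lemma exists_generalized_eigenvectors:
  fixes A B :: "real^'n^'n" and J :: "'n set"
  assumes A: "pos_def A" and B: "B \<in> sym_matrices"
  shows "\<exists>v \<mu>. (\<forall>i\<in>J. B *v v i = \<mu> i *\<^sub>R (A *v v i)) \<and>
    (\<forall>i\<in>J. \<forall>j\<in>J. v i \<bullet> (A *v v j) = (if i = j then 1 else 0))"
proof (induction J rule: finite_induct[OF finite])
  case 1
  show ?case by simp
next
  case (2 k J)
  then obtain v :: "'n \<Rightarrow> real^'n" and \<mu> where ev: "\<And>i. i \<in> J \<Longrightarrow> B *v v i = \<mu> i *\<^sub>R (A *v v i)"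
    and on: "\<And>i j. i \<in> J \<Longrightarrow> j \<in> J \<Longrightarrow> v i \<bullet> (A *v v j) = (if i = j then 1 else 0)"
    by blast
  have As: "A \<in> sym_matrices" and Ap: "\<And>x. x \<noteq> 0 \<Longrightarrow> 0 < x \<bullet> (A *v x)"
    using A by (auto simp: pos_def_def)
  define W where "W = {x. \<forall>i\<in>J. x \<bullet> (A *v v i) = 0}"
  have W: "subspace W" by (auto simp: W_def subspace_def inner_add_left)
  \<comment> \<open>The new index \<open>k\<close> lies outside \<open>J\<close>, so the vectors
    \<open>A *v v i\<close> span a proper subspace and \<open>W\<close> contains some nonzero
    \<open>z\<close>.\<close>
  have "card J < CARD('n)"
    using 2 by (intro psubset_card_mono) auto
  then have "card ((\<lambda>i. A *v v i) ` J) < CARD('n)"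
    by (meson card_image_le finite le_less_trans)
  then have "dim (span ((\<lambda>i. A *v v i) ` J)) < DIM(real^'n)"
    using dim_le_card'[of "(\<lambda>i. A *v v i) ` J"] by simp
  then obtain z where z: "z \<noteq> 0" "\<And>y. y \<in> span ((\<lambda>i. A *v v i) ` J) \<Longrightarrow> orthogonal z y"
    using orthogonal_to_subspace_exists[of "(\<lambda>i. A *v v i) ` J"] by (metis dim_span)
  then have zW: "z \<in> W"
    by (auto simp: W_def orthogonal_def span_base)
  \<comment> \<open>The quotient \<open>f\<close> is invariant under scaling, so maximising over the
    compact unit sphere of \<open>W\<close> maximises over all nonzero vectors of
    \<open>W\<close>.\<close>
  define K where "K = W \<inter> sphere 0 1"
  define f where "f x = (x \<bullet> (B *v x)) / (x \<bullet> (A *v x))" for x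
  have Ap0: "x \<bullet> (A *v x) \<noteq> 0" if "x \<in> K" for x
    using Ap[of x] that by (force simp: K_def)
  have "compact K" using W by (simp add: K_def closed_Int_compact closed_subspace)
  moreover have "K \<noteq> {}"
  proof -
    have "(1 / norm z) *\<^sub>R z \<in> K"
      using z(1) zW W by (auto simp: K_def subspace_scale)
    then show ?thesis by blast
  qed
  moreover have "continuous_on K f"
    unfolding f_def
    by (intro continuous_intros linear_continuous_on linear_linear[THEN iffD2]) (simp_all add: Ap0)
  ultimately obtain u where u: "u \<in> K" and max: "\<And>y. y \<in> K \<Longrightarrow> f y \<le> f u"
    using continuous_attains_sup by metis
  define m where "m = f u"
  have u0: "u \<noteq> 0" and uW: "u \<in> W" using u by (auto simp: K_def)
  define M where "M = m *\<^sub>R A - B"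
  have Ms: "M \<in> sym_matrices"
    unfolding M_def using As B by (intro sym_matrices_diff sym_matrices_scaleR)
  have Mq: "x \<bullet> (M *v y) = m * (x \<bullet> (A *v y)) - x \<bullet> (B *v y)" for x y
    by (simp add: M_def quadratic_form_simps)
  have nonneg: "0 \<le> w \<bullet> (M *v w)" if w: "w \<in> W" for w
  proof (cases "w = 0")
    case False
    define a where "a = 1 / norm w"
    have "a *\<^sub>R w \<in> K" using w W False by (auto simp: K_def a_def subspace_scale)
    from max[OF this] have "f (a *\<^sub>R w) \<le> m" by (simp add: m_def)
    moreover have "f (a *\<^sub>R w) = f w"
      using False by (simp add: f_def a_def quadratic_form_simps)
    ultimately have "f w \<le> m" by simp
    then show ?thesis using Ap[OF False] by (simp add: f_def Mq pos_divide_le_eq)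
  qed simp
  have "u \<bullet> (M *v u) = 0" using Ap[OF u0] by (simp add: Mq m_def f_def)
  then have MuW: "w \<bullet> (M *v u) = 0" if "w \<in> W" for w
    using nonneg_form_null_vector[OF Ms W nonneg uW] that by blast
  \<comment> \<open>By symmetry \<open>M\<close> may act on \<open>v i\<close> instead, where it
    gives a multiple of \<open>A *v v i\<close>, which is orthogonal to \<open>u\<close>.\<close>
  have Muv: "v i \<bullet> (M *v u) = 0" if "i \<in> J" for i
  proof -
    have "v i \<bullet> (M *v u) = u \<bullet> (M *v v i)" by (rule sym_matrices_inner_commute[OF Ms])
    also have "\<dots> = 0" using that uW by (simp add: Mq ev W_def)
    finally show ?thesis .
  qed
  \<comment> \<open>Here \<open>s\<close> is the \<open>A\<close>-orthogonal projection of
    \<open>y\<close> onto the span of the \<open>v i\<close>. The remainder \<open>y - s\<close>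
    lies in \<open>W\<close>, so \<open>M *v u\<close> is orthogonal to both pieces.\<close>
  have "y \<bullet> (M *v u) = 0" for y
  proof -
    define s where "s = (\<Sum>i\<in>J. (y \<bullet> (A *v v i)) *\<^sub>R v i)"
    have "s \<bullet> (A *v v j) = y \<bullet> (A *v v j)" if "j \<in> J" for j
      using that 2(1) by (simp add: s_def inner_sum_left on if_distrib cong: if_cong)
    then have "y - s \<in> W" by (simp add: W_def inner_diff_left)
    then have "(y - s) \<bullet> (M *v u) = 0" by (rule MuW)
    moreover have "s \<bullet> (M *v u) = 0" by (simp add: s_def inner_sum_left Muv)
    ultimately show ?thesis by (simp add: inner_diff_left)
  qed
  then have "M *v u = 0" by (metis inner_eq_zero_iff)
  then have Bu: "B *v u = m *\<^sub>R (A *v u)" by (simp add: M_def quadratic_form_simps)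
  \<comment> \<open>Rescaling by \<open>r\<close> normalises \<open>u\<close> to have
    \<open>A\<close>-form 1.\<close>
  define r where "r = 1 / sqrt (u \<bullet> (A *v u))"
  have r: "r * (r * (u \<bullet> (A *v u))) = 1"
    using Ap[OF u0] by (simp add: r_def field_simps)
  have uv: "u \<bullet> (A *v v i) = 0" "v i \<bullet> (A *v u) = 0" if "i \<in> J" for i
    using that uW sym_matrices_inner_commute[OF As, of "v i" u] by (simp_all add: W_def)
  show ?case
  proof (rule exI[of _ "v(k := r *\<^sub>R u)"], rule exI[of _ "\<mu>(k := m)"], intro conjI ballI)
    fix i assume "i \<in> insert k J"
    then show "B *v (v(k := r *\<^sub>R u)) i = (\<mu>(k := m)) i *\<^sub>R (A *v (v(k := r *\<^sub>R u)) i)"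
      using ev by (auto simp: Bu quadratic_form_simps)
  next
    fix i j assume "i \<in> insert k J" "j \<in> insert k J"
    then show "(v(k := r *\<^sub>R u)) i \<bullet> (A *v (v(k := r *\<^sub>R u)) j) = (if i = j then 1 else 0)"
      using on uv r 2(2) by (auto simp: quadratic_form_simps)
  qed
qed

lemma matrix_scaleR_mult_left: "(c *\<^sub>R A) ** B = c *\<^sub>R (A ** B)" for A :: "real^'n^'m"
  by (rule scalar_matrix_assoc[symmetric])

lemma matrix_add_mult_right: "(A + B) ** C = A ** C + B ** C" for A B :: "real^'n^'m"
  by (simp add: matrix_matrix_mult_def vec_eq_iff distrib_right sum.distrib)

lemma congruence_component:
  fixes C M :: "real^'n^'n"
  shows "(transpose C ** M ** C) $ i $ j = column i C \<bullet> (M *v column j C)"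
proof -
  have "column i C \<bullet> (M *v column j C) = row i (transpose C) \<bullet> (M *v (C *v axis j 1))"
    by (simp add: row_transpose matrix_vector_mult_basis)
  also have "\<dots> = (transpose C *v (M *v (C *v axis j 1))) $ i"
    by (simp add: matrix_vector_mul_component row_def del: transpose_matrix_vector)
  also have "\<dots> = ((transpose C ** M ** C) *v axis j 1) $ i"
    by (simp only: matrix_vector_mul_assoc matrix_mul_assoc)
  also have "\<dots> = (transpose C ** M ** C) $ i $ j"
    by (simp only: matrix_vector_mult_basis) (simp add: column_def)
  finally show ?thesis by simp
qed

text \<open>The columns of \<open>C\<close> are the \<open>A\<close>-orthonormal generalised
  eigenvectors, taken over the full index set.\<close>

lemma simultaneous_diagonalization:
  fixes A B :: "real^'n^'n"
  assumes "pos_def A" and "B \<in> sym_matrices"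
  obtains C :: "real^'n^'n" and \<mu> :: "'n \<Rightarrow> real" where
    "transpose C ** A ** C = mat 1"
    "transpose C ** B ** C = (\<chi> i j. if i = j then \<mu> i else 0)"
proof -
  obtain v :: "'n \<Rightarrow> real^'n" and \<mu> where ev: "\<And>i. B *v v i = \<mu> i *\<^sub>R (A *v v i)"
    and on: "\<And>i j. v i \<bullet> (A *v v j) = (if i = j then 1 else 0)"
    using exists_generalized_eigenvectors[OF assms, of UNIV] by auto
  define C :: "real^'n^'n" where "C = (\<chi> a i. v i $ a)"
  have col: "column i C = v i" for i by (simp add: C_def column_def vec_eq_iff)
  show thesis
  proof (rule that[of C \<mu>])
    show "transpose C ** A ** C = mat 1"
      by (simp add: vec_eq_iff congruence_component col on mat_def)
    show "transpose C ** B ** C = (\<chi> i j. if i = j then \<mu> i else 0)"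
      by (simp add: vec_eq_iff congruence_component col on ev)
  qed
qed

section \<open>Determinants: positivity, monotonicity and strict log-concavity\<close>

lemma det_congruence:
  fixes C M :: "real^'n^'n"
  shows "det (transpose C ** M ** C) = (det C)\<^sup>2 * det M"
  by (simp add: det_mul det_transpose power2_eq_square)

text \<open>Diagonalising \<open>A\<close> against itself shows that a square times
  \<open>det A\<close> equals 1.\<close>

lemma det_pos_if_pos_def:
  fixes A :: "real^'n^'n"
  assumes "pos_def A"
  shows "0 < det A"
proof -
  from assms have "A \<in> sym_matrices" by (simp add: pos_def_def)
  with assms obtain C :: "real^'n^'n" where "transpose C ** A ** C = mat 1"
    by (rule simultaneous_diagonalization)
  then have "(det C)\<^sup>2 * det A = 1" by (metis det_congruence det_I)
  then show ?thesis by (smt (verit) mult_nonneg_nonpos zero_le_power2)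
qed

text \<open>Common source of the two determinant comparisons below. The vectors \<open>v i\<close>
  are exported so that sign conditions on the forms become conditions on the numbers
  \<open>\<mu> i\<close>; the last clause locates the case of equality.\<close>

lemma det_congruent_diagonal:
  fixes A B :: "real^'n^'n"
  assumes A: "pos_def A" and B: "B \<in> sym_matrices"
  obtains v :: "'n \<Rightarrow> real^'n" and \<mu> :: "'n \<Rightarrow> real" where
    "\<And>i. v i \<noteq> 0" "\<And>i. v i \<bullet> (A *v v i) = 1" "\<And>i. v i \<bullet> (B *v v i) = \<mu> i"
    "\<And>s t. det (s *\<^sub>R A + t *\<^sub>R B) = det A * (\<Prod>i\<in>UNIV. s + t * \<mu> i)"
    "(\<forall>i. \<mu> i = 1) \<longrightarrow> A = B"
proof -
  obtain C :: "real^'n^'n" and \<mu> where CA: "transpose C ** A ** C = mat 1"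
    and CB: "transpose C ** B ** C = (\<chi> i j. if i = j then \<mu> i else 0)"
    by (rule simultaneous_diagonalization[OF assms])
  have dC: "(det C)\<^sup>2 * det A = 1" using CA by (metis det_congruence det_I)
  show thesis
  proof (rule that[of "\<lambda>i. column i C" \<mu>])
    show vA: "column i C \<bullet> (A *v column i C) = 1" for i
      unfolding congruence_component[symmetric] CA by (simp add: mat_def)
    then show "column i C \<noteq> 0" for i
      by (metis inner_zero_left zero_neq_one)
    show "column i C \<bullet> (B *v column i C) = \<mu> i" for i
      unfolding congruence_component[symmetric] CB by simp
    show "det (s *\<^sub>R A + t *\<^sub>R B) = det A * (\<Prod>i\<in>UNIV. s + t * \<mu> i)" for s t
    proof -
      have "transpose C ** (s *\<^sub>R A + t *\<^sub>R B) ** C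
          = s *\<^sub>R (transpose C ** A ** C) + t *\<^sub>R (transpose C ** B ** C)"
        by (simp add: matrix_add_ldistrib matrix_add_mult_right matrix_scalar_ac matrix_scaleR_mult_left)
      also have "\<dots> = (\<chi> i j. if i = j then s + t * \<mu> i else 0)"
        unfolding CA CB by (simp add: vec_eq_iff mat_def)
      finally have "(det C)\<^sup>2 * det (s *\<^sub>R A + t *\<^sub>R B) = det (\<chi> i j. if i = j then s + t * \<mu> i else 0)"
        by (metis det_congruence)
      also have "\<dots> = (\<Prod>i\<in>UNIV. s + t * \<mu> i)"
        by (subst det_diagonal) auto
      finally have "det A * (\<Prod>i\<in>UNIV. s + t * \<mu> i) = ((det C)\<^sup>2 * det A) * det (s *\<^sub>R A + t *\<^sub>R B)"
        by (simp add: mult_ac)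
      then show ?thesis using dC by simp
    qed
    show "(\<forall>i. \<mu> i = 1) \<longrightarrow> A = B"
    proof
      assume "\<forall>i. \<mu> i = 1"
      then have "transpose C ** B ** C = mat 1" unfolding CB by (simp add: vec_eq_iff mat_def)
      with CA have eq: "transpose C ** A ** C = transpose C ** B ** C" by simp
      \<comment> \<open>An invertible \<open>C\<close> allows the congruence to be undone by its
        inverse \<open>D\<close>.\<close>
      have "det C \<noteq> 0" using dC by auto
      then obtain D :: "real^'n^'n" where D: "C ** D = mat 1"
        by (metis invertible_det_nz invertible_right_inverse)
      then have D': "transpose D ** transpose C = mat 1"
        by (metis matrix_transpose_mul transpose_mat)
      have red: "transpose D ** (transpose C ** M ** C) ** D = M" for M
      proof -
        have "transpose D ** (transpose C ** M ** C) ** D = (transpose D ** transpose C) ** M ** (C ** D)"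
          by (simp only: matrix_mul_assoc)
        then show ?thesis using D D' by simp
      qed
      have "A = transpose D ** (transpose C ** A ** C) ** D" by (rule red[symmetric])
      also have "\<dots> = B" unfolding eq by (rule red)
      finally show "A = B" .
    qed
  qed
qed

text \<open>Relative to \<open>A\<close>, the hypothesis says that every \<open>\<mu> i\<close> is
  at least 1, and \<open>det B / det A\<close> is their product.\<close>

lemma det_mono_pos_semidef:
  fixes A B :: "real^'n^'n"
  assumes A: "pos_def A" and BA: "pos_semidef (B - A)"
  shows "det A \<le> det B"
proof -
  have "B = (B - A) + A" by simp
  then have "B \<in> sym_matrices"
    using A BA sym_matrices_add unfolding pos_def_def pos_semidef_def by metis
  from det_congruent_diagonal[OF A this]
  obtain v :: "'n \<Rightarrow> real^'n" and \<mu> :: "'n \<Rightarrow> real" where v: "\<And>i. v i \<noteq> 0"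
      "\<And>i. v i \<bullet> (A *v v i) = 1" "\<And>i. v i \<bullet> (B *v v i) = \<mu> i"
    and d: "\<And>s t. det (s *\<^sub>R A + t *\<^sub>R B) = det A * (\<Prod>i\<in>UNIV. s + t * \<mu> i)"
    and "(\<forall>i. \<mu> i = 1) \<longrightarrow> A = B"
    by blast
  have "1 \<le> \<mu> i" for i
  proof -
    have "0 \<le> v i \<bullet> ((B - A) *v v i)" using BA by (simp add: pos_semidef_def)
    then show ?thesis using v by (simp add: quadratic_form_simps)
  qed
  then have "1 \<le> (\<Prod>i\<in>UNIV. \<mu> i)" by (intro prod_ge_1)
  then show ?thesis using d[of 0 1] det_pos_if_pos_def[OF A] by simp
qed

text \<open>Strict concavity of \<open>ln\<close> between 1 and \<open>x\<close>. With
  \<open>y\<close> the convex combination, the bound \<open>ln z < z - 1\<close> is applied at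
  \<open>x / y\<close> and \<open>1 / y\<close>, both different from 1; with weights
  \<open>t\<close> and \<open>1 - t\<close> the right-hand sides cancel.\<close>

lemma ln_affine_gt:
  fixes x t :: real
  assumes "0 < x" "x \<noteq> 1" "0 < t" "t < 1"
  shows "t * ln x < ln (1 - t + t * x)"
proof -
  define y where "y = 1 - t + t * x"
  have y: "0 < y" using assms by (auto simp: y_def intro: add_pos_pos)
  have xy: "x - y = (1 - t) * (x - 1)" "1 - y = - t * (x - 1)" by (auto simp: y_def algebra_simps)
  have "x \<noteq> y" "1 \<noteq> y" using xy assms by auto
  then have 1: "ln (x / y) < x / y - 1" "ln (1 / y) < 1 / y - 1"
    using y assms ln_le_minus_one[of "x / y"] ln_eq_minus_one[of "x / y"]
      ln_le_minus_one[of "1 / y"] ln_eq_minus_one[of "1 / y"] by (auto simp: less_le)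
  have "t * ln (x / y) + (1 - t) * ln (1 / y) < t * (x / y - 1) + (1 - t) * (1 / y - 1)"
    using 1 assms by (intro add_strict_mono mult_strict_left_mono) auto
  also have "\<dots> = (t * x + (1 - t)) / y - 1"
    by (simp add: add_divide_distrib right_diff_distrib)
  also have "\<dots> = 0" using y by (simp add: y_def algebra_simps)
  finally have "t * (ln x - ln y) + (1 - t) * (0 - ln y) < 0"
    using y assms by (simp add: ln_div)
  then show ?thesis unfolding y_def[symmetric] by (simp add: algebra_simps)
qed

text \<open>Diagonalisation reduces the claim to the scalar inequality for each
  \<open>\<mu> i\<close>. One strict term suffices, and it exists because
  \<open>A \<noteq> B\<close> forces some \<open>\<mu> k \<noteq> 1\<close>.\<close>

lemma ln_det_strictly_concave:
  fixes A B :: "real^'n^'n"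
  assumes A: "pos_def A" and B: "pos_def B" and ne: "A \<noteq> B" and t: "0 < t" "t < 1"
  shows "(1 - t) * ln (det A) + t * ln (det B) < ln (det ((1 - t) *\<^sub>R A + t *\<^sub>R B))"
proof -
  have "B \<in> sym_matrices" using B by (simp add: pos_def_def)
  from det_congruent_diagonal[OF A this]
  obtain v :: "'n \<Rightarrow> real^'n" and \<mu> :: "'n \<Rightarrow> real" where v: "\<And>i. v i \<noteq> 0"
      "\<And>i. v i \<bullet> (A *v v i) = 1" "\<And>i. v i \<bullet> (B *v v i) = \<mu> i"
    and d: "\<And>s t. det (s *\<^sub>R A + t *\<^sub>R B) = det A * (\<Prod>i\<in>UNIV. s + t * \<mu> i)"
    and \<mu>1: "(\<forall>i. \<mu> i = 1) \<longrightarrow> A = B"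
    by blast
  have pos: "0 < \<mu> i" for i using B v by (metis pos_def_def)
  have pos': "0 < 1 - t + t * \<mu> i" for i using pos[of i] t by (auto intro: add_pos_pos)
  have dA: "0 < det A" using A by (rule det_pos_if_pos_def)
  obtain k where k: "\<mu> k \<noteq> 1" using \<mu>1 ne by blast
  have le: "t * ln (\<mu> i) \<le> ln (1 - t + t * \<mu> i)" for i
    using ln_affine_gt[OF pos[of i] _ t] by (cases "\<mu> i = 1") auto
  have "t * (\<Sum>i\<in>UNIV. ln (\<mu> i)) < (\<Sum>i\<in>UNIV. ln (1 - t + t * \<mu> i))"
    unfolding sum_distrib_left
    by (rule sum_strict_mono_ex1) (use le ln_affine_gt[OF pos[of k] k t] in auto)
  moreover have "ln (det B) = ln (det A) + (\<Sum>i\<in>UNIV. ln (\<mu> i))"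
    using d[of 0 1] dA pos by (simp add: ln_mult_pos prod_pos ln_prod less_imp_neq[symmetric])
  moreover have "ln (det ((1 - t) *\<^sub>R A + t *\<^sub>R B)) = ln (det A) + (\<Sum>i\<in>UNIV. ln (1 - t + t * \<mu> i))"
    using d[of "1 - t" t] dA pos' by (simp add: ln_mult_pos prod_pos ln_prod less_imp_neq[symmetric])
  ultimately show ?thesis by (simp add: algebra_simps)
qed

text \<open>A null vector of a semidefinite form lies in the kernel of the matrix, which is trivial
  here. This recovers definiteness from conditions that survive limits: semidefiniteness and a
  positive lower bound on the determinant.\<close>

lemma pos_def_if_pos_semidef_det_pos:
  fixes Z :: "real^'n^'n"
  assumes Z: "pos_semidef Z" and d: "0 < det Z"
  shows "pos_def Z"
proof -
  have Zs: "Z \<in> sym_matrices" using Z by (simp add: pos_semidef_def)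
  have "0 < x \<bullet> (Z *v x)" if x: "x \<noteq> 0" for x
  proof (rule ccontr)
    assume "\<not> 0 < x \<bullet> (Z *v x)"
    with Z have x0: "x \<bullet> (Z *v x) = 0" by (metis less_eq_real_def pos_semidef_def)
    have "w \<bullet> (Z *v x) = 0" for w
      using nonneg_form_null_vector[OF Zs subspace_UNIV _ _ x0] Z by (auto simp: pos_semidef_def)
    then have "Z *v x = 0" by (metis inner_eq_zero_iff)
    moreover have "invertible Z" using d by (simp add: invertible_det_nz)
    ultimately show False using x
      by (metis invertible_left_inverse matrix_left_invertible_ker)
  qed
  then show ?thesis using Zs by (simp add: pos_def_def)
qed

section \<open>Definiteness of inverses and of diagonal parts\<close>

lemma matrix_inv_mult:
  fixes A :: "real^'n^'n"
  assumes "invertible A"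
  shows "A ** matrix_inv A = mat 1" and "matrix_inv A ** A = mat 1"
  using someI_ex[OF assms[unfolded invertible_def]] by (simp_all add: matrix_inv_def)

text \<open>The transposed inverse is a left inverse of the symmetric \<open>S\<close>, hence equals
  the inverse. Substituting \<open>x = S *v y\<close> turns the form of the inverse at
  \<open>x\<close> into the form of \<open>S\<close> at \<open>y\<close>.\<close>

lemma pos_def_matrix_inv:
  fixes S :: "real^'n^'n"
  assumes S: "pos_def S"
  shows "pos_def (matrix_inv S)"
proof -
  have Ss: "S \<in> sym_matrices" and Sp: "\<And>x. x \<noteq> 0 \<Longrightarrow> 0 < x \<bullet> (S *v x)"
    using S by (auto simp: pos_def_def)
  have "invertible S" using det_pos_if_pos_def[OF S] by (simp add: invertible_det_nz)
  then have inv: "S ** matrix_inv S = mat 1" "matrix_inv S ** S = mat 1"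
    by (rule matrix_inv_mult)+
  have "transpose (matrix_inv S) ** S = mat 1"
    using inv(1) Ss by (metis (mono_tags) matrix_transpose_mul mem_Collect_eq sym_matrices_def transpose_mat)
  then have "transpose (matrix_inv S) = matrix_inv S"
    using inv(1) by (metis matrix_mul_assoc matrix_mul_lid matrix_mul_rid)
  moreover have "0 < x \<bullet> (matrix_inv S *v x)" if "x \<noteq> 0" for x
  proof -
    define y where "y = matrix_inv S *v x"
    have x: "x = S *v y" using inv(1) by (simp add: y_def matrix_vector_mul_assoc)
    then have "y \<noteq> 0" using that by auto
    from Sp[OF this] show ?thesis by (simp add: y_def[symmetric] x[symmetric] inner_commute)
  qed
  ultimately show ?thesis by (simp add: pos_def_def sym_matrices_def)
qed

lemma quadratic_form_axis: "axis i 1 \<bullet> (A *v axis i 1) = A $ i $ i" for A :: "real^'n^'n"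
  by (simp only: matrix_vector_mult_basis) (simp add: inner_axis' column_def)

lemma quadratic_form_diag2: "x \<bullet> (diag2 A *v x) = (\<Sum>i\<in>UNIV. A $ i $ i * (x $ i)\<^sup>2)"
proof -
  have "(diag2 A *v x) $ i = A $ i $ i * x $ i" for i
    by (simp add: matrix_vector_mult_def diag2_def mult_delta_left)
  then show ?thesis by (simp add: inner_vec_def power2_eq_square mult_ac)
qed

lemma pos_semidef_diag2_iff: "pos_semidef (diag2 A) \<longleftrightarrow> (\<forall>i. 0 \<le> A $ i $ i)"
proof
  assume "pos_semidef (diag2 A)"
  then have "0 \<le> axis i 1 \<bullet> (diag2 A *v axis i 1)" for i by (simp add: pos_semidef_def)
  then show "\<forall>i. 0 \<le> A $ i $ i" unfolding quadratic_form_axis by (simp add: diag2_def)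
next
  assume "\<forall>i. 0 \<le> A $ i $ i"
  then show "pos_semidef (diag2 A)"
    by (simp add: pos_semidef_def sym_matrices_diag2 quadratic_form_diag2 sum_nonneg)
qed

lemma pos_def_diag2:
  assumes "pos_def A" shows "pos_def (diag2 A)"
proof -
  have d: "0 < A $ i $ i" for i
    using assms quadratic_form_axis[of i A] by (metis axis_eq_0_iff pos_def_def zero_neq_one)
  have "0 < (\<Sum>i\<in>UNIV. A $ i $ i * (x $ i)\<^sup>2)" if x: "x \<noteq> 0" for x
  proof -
    obtain k where "x $ k \<noteq> 0" using x by (auto simp: vec_eq_iff)
    then show ?thesis
      using d by (intro sum_pos2[of _ k]) (auto simp: less_imp_le)
  qed
  then show ?thesis by (simp add: pos_def_def sym_matrices_diag2 quadratic_form_diag2)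
qed

section \<open>Change of variables from \<open>(l, X)\<close> to \<open>(l, Z)\<close> with
  \<open>Z = P + X / l\<close>\<close>

definition scaled_feasible :: "real^'n^'n \<Rightarrow> (real \<times> (real^'n^'n)) set" where
  "scaled_feasible P = {(l, Z). 0 < l \<and> pos_def Z \<and> (\<forall>i. Z $ i $ i \<le> P $ i $ i) \<and>
     pos_semidef (mat 1 - l *\<^sub>R (Z - P))}"

text \<open>The bracket in \<open>dual_obj\<close>, written with \<open>P\<close> the inverse of
  \<open>S\<close>, so that \<open>ln (det S)\<close> becomes \<open>- ln (det P)\<close>.\<close>

definition det_gain :: "real^'n^'n \<Rightarrow> real \<Rightarrow> real^'n^'n \<Rightarrow> real" where
  "det_gain P \<delta> Z = ln (det Z) - ln (det P) - \<delta>"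

text \<open>Symmetry of \<open>X\<close> is inherited from \<open>Z\<close> and \<open>P\<close>,
  and the diagonal condition on \<open>X\<close> may be divided by \<open>l > 0\<close>.\<close>

lemma mem_dual_feasible_iff:
  assumes S: "pos_def S" and l: "0 < l"
  shows "(l, l *\<^sub>R (Z - matrix_inv S)) \<in> dual_feasible S \<longleftrightarrow> (l, Z) \<in> scaled_feasible (matrix_inv S)"
proof -
  define P where "P = matrix_inv S"
  have P: "P \<in> sym_matrices" using pos_def_matrix_inv[OF S] by (simp add: P_def pos_def_def)
  have Z: "P + inverse l *\<^sub>R (l *\<^sub>R (Z - P)) = Z" using l by simp
  have "- diag2 (l *\<^sub>R (Z - P)) = diag2 (l *\<^sub>R (P - Z))"
    by (simp add: diag2_def vec_eq_iff algebra_simps)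
  then have d: "pos_semidef (- diag2 (l *\<^sub>R (Z - P))) \<longleftrightarrow> (\<forall>i. Z $ i $ i \<le> P $ i $ i)"
    using l by (simp add: pos_semidef_diag2_iff zero_le_mult_iff)
  have s: "l *\<^sub>R (Z - P) \<in> sym_matrices" if "pos_def Z"
    using that P by (intro sym_matrices_scaleR sym_matrices_diff) (auto simp: pos_def_def)
  show ?thesis
    unfolding dual_feasible_def scaled_feasible_def P_def[symmetric] mem_Collect_eq prod.case Z d
    using l s by blast
qed

lemma dual_feasible_eq:
  assumes S: "pos_def S"
  shows "dual_feasible S = (\<lambda>(l, Z). (l, l *\<^sub>R (Z - matrix_inv S))) ` scaled_feasible (matrix_inv S)"
    (is "_ = ?f ` _")
proof (intro equalityI subsetI)
  fix p assume "p \<in> dual_feasible S"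
  moreover obtain l X where p: "p = (l, X)" by fastforce
  ultimately have l: "0 < l" by (simp add: dual_feasible_def)
  define Z where "Z = matrix_inv S + inverse l *\<^sub>R X"
  have "X = l *\<^sub>R (Z - matrix_inv S)" using l by (simp add: Z_def)
  then show "p \<in> ?f ` scaled_feasible (matrix_inv S)"
    using mem_dual_feasible_iff[OF S l, of Z] \<open>p \<in> dual_feasible S\<close> p by force
next
  fix p assume "p \<in> ?f ` scaled_feasible (matrix_inv S)"
  then obtain l Z where "(l, Z) \<in> scaled_feasible (matrix_inv S)" "p = (l, l *\<^sub>R (Z - matrix_inv S))"
    by auto
  moreover have "0 < l" using calculation by (simp add: scaled_feasible_def)
  ultimately show "p \<in> dual_feasible S" using mem_dual_feasible_iff[OF S] by blast
qed

lemma det_matrix_inv_mult: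
  assumes "pos_def S"
  shows "det (matrix_inv S) * det S = 1"
proof -
  have "invertible S" using det_pos_if_pos_def[OF assms] by (simp add: invertible_det_nz)
  then have "matrix_inv S ** S = mat 1" by (rule matrix_inv_mult(2))
  then show ?thesis by (metis det_I det_mul)
qed

lemma ln_det_matrix_inv:
  assumes "pos_def S"
  shows "ln (det (matrix_inv S)) = - ln (det S)"
  using det_matrix_inv_mult[OF assms] det_pos_if_pos_def[OF assms]
    det_pos_if_pos_def[OF pos_def_matrix_inv[OF assms]]
  by (metis add_eq_0_iff2 ln_mult_pos ln_one)

lemma dual_obj_eq:
  assumes "pos_def S" and "0 < l"
  shows "dual_obj S \<delta> (l, l *\<^sub>R (Z - matrix_inv S)) = - (l * det_gain (matrix_inv S) \<delta> Z)"
  using assms by (simp add: dual_obj_def det_gain_def ln_det_matrix_inv)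

text \<open>Read with \<open>P\<close> the inverse of \<open>S\<close>, this makes
  \<open>delta_max S - \<delta>\<close> the value of \<open>det_gain P \<delta>\<close> at
  \<open>diag2 P\<close>.\<close>

lemma delta_max_eq:
  assumes "pos_def S"
  shows "delta_max S = ln (det (diag2 (matrix_inv S))) - ln (det (matrix_inv S))"
proof -
  have "0 < det (diag2 (matrix_inv S))" "0 < det S"
    using assms by (auto intro: det_pos_if_pos_def pos_def_diag2 pos_def_matrix_inv)
  then show ?thesis
    using assms by (simp add: delta_max_def det_mul ln_mult_pos ln_det_matrix_inv)
qed

section \<open>Existence of a maximiser by compactness\<close>

lemma exists_scale_below_identity:
  fixes M :: "real^'n^'n"
  assumes "M \<in> sym_matrices"
  obtains l where "0 < l" "pos_semidef (mat 1 - l *\<^sub>R M)"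
proof -
  \<comment> \<open>The form of \<open>M\<close> is at most \<open>b\<close> times the squared norm,
    so any positive \<open>l\<close> with \<open>l * b \<le> 1\<close> works;
    \<open>1 / (b + 1)\<close> is chosen because \<open>b\<close> may be 0.\<close>
  define b where "b = onorm (\<lambda>x. M *v x)"
  have bl: "bounded_linear (\<lambda>x. M *v x)" by (simp add: linear_linear)
  have b: "0 \<le> b" unfolding b_def by (rule onorm_pos_le[OF bl])
  have le: "x \<bullet> (M *v x) \<le> b * (x \<bullet> x)" for x
  proof -
    have "x \<bullet> (M *v x) \<le> norm x * norm (M *v x)" by (rule norm_cauchy_schwarz)
    also have "\<dots> \<le> norm x * (b * norm x)"
      unfolding b_def by (intro mult_left_mono onorm[OF bl]) simp
    finally show ?thesis by (simp add: dot_square_norm power2_eq_square mult_ac)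
  qed
  show thesis
  proof (rule that[of "1 / (b + 1)"])
    show "0 < 1 / (b + 1)" using b by simp
    have "0 \<le> x \<bullet> x - x \<bullet> (M *v x) / (b + 1)" for x
    proof -
      have "x \<bullet> (M *v x) \<le> (b + 1) * (x \<bullet> x)"
        using le[of x] inner_ge_zero[of x] by (simp only: distrib_right mult_1)
      then show ?thesis using b by (simp add: pos_divide_le_eq mult_ac)
    qed
    then show "pos_semidef (mat 1 - (1 / (b + 1)) *\<^sub>R M)"
      using assms by (simp add: pos_semidef_def sym_matrices_diff sym_matrices_mat
          sym_matrices_scaleR quadratic_form_simps)
  qed
qed

lemma continuous_on_det [continuous_intros]:
  fixes f :: "'a::topological_space \<Rightarrow> real^'n^'n"
  shows "continuous_on T f \<Longrightarrow> continuous_on T (\<lambda>x. det (f x))"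
  unfolding det_def by (intro continuous_intros)

lemma continuous_on_quadratic_form [continuous_intros]:
  fixes f :: "'a::topological_space \<Rightarrow> real^'n^'n"
  shows "continuous_on T f \<Longrightarrow> continuous_on T (\<lambda>p. x \<bullet> (f p *v x))"
  unfolding inner_vec_def matrix_vector_mult_def by (simp, intro continuous_intros)

lemma closed_pos_semidef_preimage:
  fixes f :: "'a::topological_space \<Rightarrow> real^'n^'n"
  assumes "continuous_on UNIV f"
  shows "closed {p. pos_semidef (f p)}"
proof -
  have "{p. pos_semidef (f p)} =
      {p. \<forall>i j. f p $ j $ i = f p $ i $ j} \<inter> {p. \<forall>x. 0 \<le> x \<bullet> (f p *v x)}"
    by (auto simp: pos_semidef_def sym_matrices_def transpose_def vec_eq_iff)
  also have "closed \<dots>"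
    by (intro closed_Int closed_Collect_all closed_Collect_eq closed_Collect_le continuous_intros assms)
  finally show ?thesis .
qed

text \<open>The form is tested on the sum and the difference of two axis vectors. Upper bounds on
  the diagonal thereby bound the whole matrix.\<close>

lemma pos_semidef_abs_entry_le:
  assumes "pos_semidef Z"
  shows "\<bar>Z $ i $ j\<bar> \<le> (Z $ i $ i + Z $ j $ j) / 2"
proof -
  have e: "axis a 1 \<bullet> (Z *v axis b 1) = Z $ a $ b" for a b
    by (simp only: matrix_vector_mult_basis) (simp add: inner_axis' column_def)
  have "Z $ j $ i = Z $ i $ j"
    using assms by (metis (mono_tags) e pos_semidef_def sym_matrices_inner_commute)
  moreover have "0 \<le> (axis i 1 + axis j 1) \<bullet> (Z *v (axis i 1 + axis j 1))"
    "0 \<le> (axis i 1 - axis j 1) \<bullet> (Z *v (axis i 1 - axis j 1))"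
    using assms unfolding pos_semidef_def by blast+
  ultimately show ?thesis unfolding quadratic_form_simps e by simp
qed

lemma norm_matrix_le_sum: "norm Z \<le> (\<Sum>i\<in>UNIV. \<Sum>j\<in>UNIV. \<bar>Z $ i $ j\<bar>)" for Z :: "real^'n^'m"
proof -
  have "norm Z \<le> (\<Sum>i\<in>UNIV. norm (Z $ i))"
    unfolding norm_vec_def[of Z] by (rule L2_set_le_sum) simp
  also have "\<dots> \<le> (\<Sum>i\<in>UNIV. \<Sum>j\<in>UNIV. \<bar>Z $ i $ j\<bar>)"
    by (intro sum_mono norm_le_l1_cart)
  finally show ?thesis .
qed

text \<open>The strict conditions \<open>0 < l\<close> and \<open>pos_def Z\<close> are relaxed to
  closed ones. Boundedness comes from \<open>0 \<le> l \<le> L\<close> and from the diagonal bounds,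
  which control every entry of \<open>Z\<close>.\<close>

lemma compact_scaled_region:
  fixes P :: "real^'n^'n"
  shows "compact {(l, Z). 0 \<le> l \<and> l \<le> L \<and> pos_semidef Z \<and> (\<forall>i. Z $ i $ i \<le> P $ i $ i) \<and>
    pos_semidef (mat 1 - l *\<^sub>R (Z - P)) \<and> c \<le> det Z}" (is "compact ?K")
proof -
  have "?K = {p. 0 \<le> fst p} \<inter> {p. fst p \<le> L} \<inter> {p. pos_semidef (snd p)} \<inter>
      {p. \<forall>i. snd p $ i $ i \<le> P $ i $ i} \<inter> {p. pos_semidef (mat 1 - fst p *\<^sub>R (snd p - P))} \<inter>
      {p. c \<le> det (snd p)}"
    by auto
  also have "closed \<dots>"
    by (intro closed_Int closed_Collect_all closed_pos_semidef_preimage closed_Collect_le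
        continuous_intros)
  finally have "closed ?K" .
  moreover have "bounded ?K"
  proof -
    define R where "R = (\<Sum>i\<in>UNIV. \<Sum>j\<in>UNIV. (P $ i $ i + P $ j $ j) / 2)"
    have "norm Z \<le> R" if "pos_semidef Z" "\<forall>i. Z $ i $ i \<le> P $ i $ i" for Z
    proof -
      have "\<bar>Z $ i $ j\<bar> \<le> (P $ i $ i + P $ j $ j) / 2" for i j
      proof -
        have "(Z $ i $ i + Z $ j $ j) / 2 \<le> (P $ i $ i + P $ j $ j) / 2"
          using that(2) by (intro divide_right_mono add_mono) auto
        with pos_semidef_abs_entry_le[OF that(1)] show ?thesis by (rule order_trans)
      qed
      then have "(\<Sum>i\<in>UNIV. \<Sum>j\<in>UNIV. \<bar>Z $ i $ j\<bar>) \<le> R"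
        unfolding R_def by (intro sum_mono)
      then show ?thesis using norm_matrix_le_sum[of Z] by linarith
    qed
    then have "?K \<subseteq> {0..L} \<times> cball 0 R" by auto
    then show ?thesis by (rule bounded_subset[rotated]) (intro bounded_Times bounded_closed_interval bounded_cball)
  qed
  ultimately show ?thesis by (simp add: compact_eq_bounded_closed)
qed

lemma scale_bounded:
  fixes P :: "real^'n^'n"
  assumes P: "pos_def P" and c: "det P < c"
  obtains L where "\<And>l Z. (l, Z) \<in> scaled_feasible P \<Longrightarrow> c \<le> det Z \<Longrightarrow> l \<le> L"
proof -
  \<comment> \<open>The variable \<open>t\<close> stands for \<open>1 / l\<close>. Near
    \<open>t = 0\<close> the determinant of \<open>P + t I\<close> stays below \<open>c\<close>,
    whereas feasibility with \<open>c \<le> det Z\<close> would force it to be at least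
    \<open>c\<close>.\<close>
  have "continuous_on UNIV (\<lambda>t::real. det (P + t *\<^sub>R mat 1))" by (intro continuous_intros)
  then have "isCont (\<lambda>t::real. det (P + t *\<^sub>R mat 1)) 0" by (simp add: continuous_on_eq_continuous_at)
  then have "\<forall>\<^sub>F t in at 0. det (P + t *\<^sub>R mat 1) < c"
    using c by (intro order_tendstoD(2)[of _ "det P"]) (simp_all add: isCont_def)
  then obtain r where r: "0 < r" "\<And>t. t \<noteq> 0 \<Longrightarrow> \<bar>t\<bar> < r \<Longrightarrow> det (P + t *\<^sub>R mat 1) < c"
    by (auto simp: eventually_at dist_real_def)
  show thesis
  proof (rule that[of "1 / r"], rule ccontr)
    fix l Z assume F: "(l, Z) \<in> scaled_feasible P" and Z: "c \<le> det Z" and "\<not> l \<le> 1 / r"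
    then have l: "0 < l" "1 / l < r"
      using r(1) by (auto simp: scaled_feasible_def field_simps)
    have Zp: "pos_def Z" and psd: "pos_semidef (mat 1 - l *\<^sub>R (Z - P))"
      using F by (auto simp: scaled_feasible_def)
    have eq: "P + (1 / l) *\<^sub>R mat 1 - Z = (1 / l) *\<^sub>R (mat 1 - l *\<^sub>R (Z - P))"
      using l by (simp add: algebra_simps)
    have "pos_semidef (P + (1 / l) *\<^sub>R mat 1 - Z)"
      unfolding eq using psd l
      by (simp add: pos_semidef_def sym_matrices_scaleR matrix_vector_scaleR_left)
    from det_mono_pos_semidef[OF Zp this] Z have "c \<le> det (P + (1 / l) *\<^sub>R mat 1)" by simp
    with r(2)[of "1 / l"] l show False by simp
  qed
qed

text \<open>The witness \<open>diag2 P\<close> meets the diagonal bounds with equality and has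
  positive gain by the bound on \<open>\<delta>\<close>; a small \<open>l\<close> then secures the
  matrix inequality.\<close>

lemma positive_gain_attained:
  assumes P: "pos_def P" and \<delta>: "\<delta> < ln (det (diag2 P)) - ln (det P)"
  obtains l Z where "(l, Z) \<in> scaled_feasible P" "0 < l * det_gain P \<delta> Z"
proof -
  have "P \<in> sym_matrices" using P by (simp add: pos_def_def)
  then obtain l where l: "0 < l" "pos_semidef (mat 1 - l *\<^sub>R (diag2 P - P))"
    using exists_scale_below_identity sym_matrices_diff sym_matrices_diag2 by metis
  show thesis
    by (rule that[of l "diag2 P"])
      (use l \<delta> pos_def_diag2[OF P] in \<open>auto simp: scaled_feasible_def det_gain_def diag2_def\<close>)
qed

lemma scaled_gain_max_exists:
  fixes P :: "real^'n^'n"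
  assumes P: "pos_def P" and \<delta>: "0 < \<delta>" "\<delta> < ln (det (diag2 P)) - ln (det P)"
  obtains l Z where "(l, Z) \<in> scaled_feasible P" "0 < l * det_gain P \<delta> Z"
    "\<And>l' Z'. (l', Z') \<in> scaled_feasible P \<Longrightarrow> l' * det_gain P \<delta> Z' \<le> l * det_gain P \<delta> Z"
proof -
  \<comment> \<open>The determinant at which \<open>det_gain\<close> changes sign; it exceeds
    \<open>det P\<close> because \<open>\<delta> > 0\<close>, as the bound on \<open>l\<close>
    requires.\<close>
  define c where "c = exp \<delta> * det P"
  have dP: "0 < det P" using P by (rule det_pos_if_pos_def)
  have c: "0 < c" "det P < c" using dP \<delta> by (auto simp: c_def)
  have gain_iff: "0 \<le> det_gain P \<delta> Z \<longleftrightarrow> c \<le> det Z" if "0 < det Z" for Z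
  proof -
    have "ln c = \<delta> + ln (det P)" using dP by (simp add: c_def ln_mult_pos)
    then have "0 \<le> det_gain P \<delta> Z \<longleftrightarrow> ln c \<le> ln (det Z)" by (auto simp: det_gain_def)
    then show ?thesis using that c by simp
  qed
  obtain L where L: "\<And>l Z. (l, Z) \<in> scaled_feasible P \<Longrightarrow> c \<le> det Z \<Longrightarrow> l \<le> L"
    using scale_bounded[OF P c(2)] by metis
  \<comment> \<open>A compact set containing every feasible point of positive value.\<close>
  define K where "K = {(l, Z). 0 \<le> l \<and> l \<le> L \<and> pos_semidef Z \<and> (\<forall>i. Z $ i $ i \<le> P $ i $ i) \<and>
    pos_semidef (mat 1 - l *\<^sub>R (Z - P)) \<and> c \<le> det Z}"
  have inK: "(l, Z) \<in> K" if F: "(l, Z) \<in> scaled_feasible P" and pos: "0 < l * det_gain P \<delta> Z" for l Z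
  proof -
    have l: "0 < l" and Z: "pos_def Z" using F by (auto simp: scaled_feasible_def)
    then have "0 < det_gain P \<delta> Z" using pos by (simp add: zero_less_mult_iff)
    then have "c \<le> det Z" using gain_iff[of Z] det_pos_if_pos_def[OF Z] by simp
    moreover have "0 \<le> x \<bullet> (Z *v x)" for x
      using Z by (cases "x = 0") (auto simp: pos_def_def less_imp_le)
    ultimately show ?thesis
      using F L[OF F] by (auto simp: K_def scaled_feasible_def pos_semidef_def pos_def_def)
  qed
  obtain l0 Z0 where F0: "(l0, Z0) \<in> scaled_feasible P" and pos0: "0 < l0 * det_gain P \<delta> Z0"
    using positive_gain_attained[OF P \<delta>(2)] by metis
  have "continuous_on K (\<lambda>p. fst p * det_gain P \<delta> (snd p))"
    unfolding det_gain_def using c(1) by (intro continuous_intros) (auto simp: K_def)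
  moreover have "compact K" unfolding K_def by (rule compact_scaled_region)
  moreover have "K \<noteq> {}" using inK[OF F0 pos0] by blast
  ultimately obtain p where pK: "p \<in> K"
    and max: "\<And>q. q \<in> K \<Longrightarrow> fst q * det_gain P \<delta> (snd q) \<le> fst p * det_gain P \<delta> (snd p)"
    using continuous_attains_sup[of K "\<lambda>p. fst p * det_gain P \<delta> (snd p)"] by metis
  obtain l Z where p: "p = (l, Z)" by fastforce
  have pos: "0 < l * det_gain P \<delta> Z" using max[OF inK[OF F0 pos0]] pos0 p by simp
  \<comment> \<open>The maximiser over \<open>K\<close> is feasible: its positive value excludes
    \<open>l = 0\<close>, and \<open>det Z \<ge> c > 0\<close> excludes a singular
    \<open>Z\<close>.\<close>
  have "0 < l" using pos pK p by (auto simp: K_def less_le)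
  moreover have "pos_def Z"
    using pK p c(1) by (intro pos_def_if_pos_semidef_det_pos) (auto simp: K_def)
  ultimately have F: "(l, Z) \<in> scaled_feasible P" using pK p by (auto simp: K_def scaled_feasible_def)
  show thesis
  proof (rule that[OF F pos])
    fix l' Z' assume "(l', Z') \<in> scaled_feasible P"
    \<comment> \<open>Points of positive value lie in \<open>K\<close>; all others are beaten by the
      positive maximum.\<close>
    then show "l' * det_gain P \<delta> Z' \<le> l * det_gain P \<delta> Z"
      using inK[of l' Z'] max[of "(l', Z')"] pos p by (cases "0 < l' * det_gain P \<delta> Z'") auto
  qed
qed

section \<open>Uniqueness of the maximiser\<close>

lemma scaled_feasible_midpoint:
  fixes P :: "real^'n^'n"
  assumes F1: "(l1, Z1) \<in> scaled_feasible P" and F2: "(l2, Z2) \<in> scaled_feasible P"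
  defines "t \<equiv> l2 / (l1 + l2)"
  shows "((l1 + l2) / 2, (1 - t) *\<^sub>R Z1 + t *\<^sub>R Z2) \<in> scaled_feasible P"
proof -
  \<comment> \<open>This is the ordinary midpoint in the variables \<open>(l, X)\<close>: since
    \<open>X = l (Z - P)\<close>, averaging the \<open>X\<close> weights \<open>Z1\<close> and
    \<open>Z2\<close> in proportion to \<open>l1\<close> and \<open>l2\<close>.\<close>
  define Z where "Z = (1 - t) *\<^sub>R Z1 + t *\<^sub>R Z2"
  have l: "0 < l1" "0 < l2" using F1 F2 by (auto simp: scaled_feasible_def)
  have t: "0 < t" "t < 1" using l by (auto simp: t_def)
  have lt: "(l1 + l2) * t = l2" "(l1 + l2) * (1 - t) = l1"
    using l by (auto simp: t_def right_diff_distrib)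
  have "(l1 + l2) *\<^sub>R Z = ((l1 + l2) * (1 - t)) *\<^sub>R Z1 + ((l1 + l2) * t) *\<^sub>R Z2"
    by (simp add: Z_def scaleR_right_distrib)
  then have lZ: "(l1 + l2) *\<^sub>R Z = l1 *\<^sub>R Z1 + l2 *\<^sub>R Z2" by (simp only: lt)
  have "mat 1 - ((l1 + l2) / 2) *\<^sub>R (Z - P)
      = (1/2) *\<^sub>R (2 *\<^sub>R mat 1 - (l1 + l2) *\<^sub>R Z + (l1 + l2) *\<^sub>R P)"
    by (simp add: vec_eq_iff field_simps)
  also have "\<dots> = (1/2) *\<^sub>R ((mat 1 - l1 *\<^sub>R (Z1 - P)) + (mat 1 - l2 *\<^sub>R (Z2 - P)))"
    unfolding lZ by (simp add: vec_eq_iff algebra_simps)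
  finally have avg: "mat 1 - ((l1 + l2) / 2) *\<^sub>R (Z - P)
      = (1/2) *\<^sub>R ((mat 1 - l1 *\<^sub>R (Z1 - P)) + (mat 1 - l2 *\<^sub>R (Z2 - P)))" .
  have psd: "pos_semidef ((1/2) *\<^sub>R (A + B))" if "pos_semidef A" "pos_semidef B" for A B :: "real^'n^'n"
    using that unfolding pos_semidef_def
    by (auto intro!: sym_matrices_scaleR sym_matrices_add
        simp: matrix_vector_scaleR_left matrix_vector_mult_add_rdistrib inner_add_right)
  have "pos_def Z"
    using F1 F2 t by (auto simp: Z_def scaled_feasible_def pos_def_def matrix_vector_scaleR_left
        matrix_vector_mult_add_rdistrib inner_add_right intro!: sym_matrices_scaleR sym_matrices_add add_pos_pos)
  moreover have "Z $ i $ i \<le> P $ i $ i" for i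
  proof -
    have "Z1 $ i $ i \<le> P $ i $ i" "Z2 $ i $ i \<le> P $ i $ i"
      using F1 F2 by (auto simp: scaled_feasible_def)
    then have "(1 - t) * Z1 $ i $ i + t * Z2 $ i $ i \<le> P $ i $ i"
      using t by (intro convex_bound_le) auto
    then show ?thesis by (simp add: Z_def)
  qed
  moreover have "pos_semidef (mat 1 - ((l1 + l2) / 2) *\<^sub>R (Z - P))"
    unfolding avg using F1 F2 by (intro psd) (auto simp: scaled_feasible_def)
  ultimately show ?thesis
    using l by (simp add: scaled_feasible_def Z_def)
qed

lemma scaled_gain_max_unique:
  fixes P :: "real^'n^'n"
  assumes F1: "(l1, Z1) \<in> scaled_feasible P" and F2: "(l2, Z2) \<in> scaled_feasible P"
    and m1: "l1 * det_gain P \<delta> Z1 = m" and m2: "l2 * det_gain P \<delta> Z2 = m" and m: "0 < m"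
    and max: "\<And>l Z. (l, Z) \<in> scaled_feasible P \<Longrightarrow> l * det_gain P \<delta> Z \<le> m"
  shows "l1 = l2 \<and> Z1 = Z2"
proof -
  have l: "0 < l1" "0 < l2" and Z: "pos_def Z1" "pos_def Z2"
    using F1 F2 by (auto simp: scaled_feasible_def)
  have "Z1 = Z2"
  proof (rule ccontr)
    assume ne: "Z1 \<noteq> Z2"
    define t where "t = l2 / (l1 + l2)"
    have t: "0 < t" "t < 1" using l by (auto simp: t_def)
    have lt: "(l1 + l2) * t = l2" "(l1 + l2) * (1 - t) = l1"
      using l by (auto simp: t_def right_diff_distrib)
    let ?g = "det_gain P \<delta>" and ?Z = "(1 - t) *\<^sub>R Z1 + t *\<^sub>R Z2"
    have "(1 - t) * ?g Z1 + t * ?g Z2 < ?g ?Z"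
      using ln_det_strictly_concave[OF Z ne t] by (simp add: det_gain_def algebra_simps)
    \<comment> \<open>Multiplication by \<open>l1 + l2\<close> turns the weights
      \<open>1 - t\<close> and \<open>t\<close> into \<open>l1\<close> and \<open>l2\<close>, so the
      left side becomes \<open>2 * m\<close>.\<close>
    then have "(l1 + l2) * ((1 - t) * ?g Z1 + t * ?g Z2) < (l1 + l2) * ?g ?Z"
      using l by (intro mult_strict_left_mono) auto
    moreover have "(l1 + l2) * ((1 - t) * ?g Z1 + t * ?g Z2)
        = ((l1 + l2) * (1 - t)) * ?g Z1 + ((l1 + l2) * t) * ?g Z2"
      by (simp only: distrib_left mult.assoc)
    ultimately have "2 * m < (l1 + l2) * ?g ?Z" using m1 m2 by (simp only: lt)
    moreover have "(l1 + l2) / 2 * ?g ?Z \<le> m"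
      using max[OF scaled_feasible_midpoint[OF F1 F2]] by (simp add: t_def)
    ultimately show False by simp
  qed
  \<comment> \<open>With \<open>Z1 = Z2\<close> both scales multiply the same nonzero gain to
    \<open>m\<close>, so the gain can be cancelled.\<close>
  moreover have "det_gain P \<delta> Z1 \<noteq> 0" using m m1 by auto
  ultimately show ?thesis using m1 m2 by (metis mult_cancel_right)
qed

section \<open>Transfer back to the dual problem\<close>

theorem theoremV2:
  fixes S :: "real^'n^'n" and \<delta> :: real
  assumes "S \<in> sym_matrices" and "pos_def S"
    and "0 < \<delta>" and "\<delta> < delta_max S"
  shows "\<exists>!p. is_arg_min (dual_obj S \<delta>) (\<lambda>p. p \<in> dual_feasible S) p"
proof -
  define P where "P = matrix_inv S"
  have P: "pos_def P" unfolding P_def using assms(2) by (rule pos_def_matrix_inv)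
  have \<delta>: "\<delta> < ln (det (diag2 P)) - ln (det P)"
    using assms(4) by (simp add: delta_max_eq[OF assms(2)] P_def)
  obtain l Z where F: "(l, Z) \<in> scaled_feasible P" and pos: "0 < l * det_gain P \<delta> Z"
    and max: "\<And>l' Z'. (l', Z') \<in> scaled_feasible P \<Longrightarrow> l' * det_gain P \<delta> Z' \<le> l * det_gain P \<delta> Z"
    using scaled_gain_max_exists[OF P assms(3) \<delta>] by metis
  define f where "f = (\<lambda>(l, Z). (l, l *\<^sub>R (Z - P)))"
  have feas: "dual_feasible S = f ` scaled_feasible P"
    unfolding f_def P_def by (rule dual_feasible_eq[OF assms(2)])
  have obj: "dual_obj S \<delta> (f (l', Z')) = - (l' * det_gain P \<delta> Z')" if "(l', Z') \<in> scaled_feasible P" for l' Z'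
    using that dual_obj_eq[OF assms(2), of l'] by (simp add: f_def P_def scaled_feasible_def)
  show ?thesis
  proof (rule ex1I[of _ "f (l, Z)"])
    show "is_arg_min (dual_obj S \<delta>) (\<lambda>p. p \<in> dual_feasible S) (f (l, Z))"
      unfolding is_arg_min_linorder feas using F max by (auto simp: obj)
    fix q assume "is_arg_min (dual_obj S \<delta>) (\<lambda>p. p \<in> dual_feasible S) q"
    then have q: "q \<in> f ` scaled_feasible P" and min: "dual_obj S \<delta> q \<le> dual_obj S \<delta> (f (l, Z))"
      using F unfolding is_arg_min_linorder feas by blast+
    obtain l' Z' where q': "q = f (l', Z')" and F': "(l', Z') \<in> scaled_feasible P" using q by auto
    \<comment> \<open>Any minimiser \<open>q\<close> is the image of some scaled feasible point, and
      by the sign change in \<open>obj\<close> that point attains the maximum too.\<close>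
    have "l' * det_gain P \<delta> Z' = l * det_gain P \<delta> Z"
      using min max[OF F'] by (simp add: q' obj F F')
    from scaled_gain_max_unique[OF F' F this refl pos max] show "q = f (l, Z)"
      using q' by simp
  qed
qed

end
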